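(* Let $\mathcal R=\mathcal F_a'$ be a Våge space, regarded as a ring under addition and convolution. An element $f\in\mathcal R$ is invertible in $\mathcal R$ if and only if $E[f]$ is invertible in $\mathbb C$ (i.e. $E[f]\ne0$).
   Context: $\mathbb N=\{1,2,\dots\}$, $\mathbb N_0=\mathbb N\cup\{0\}$. For $A\subseteq\mathbb N$, $\ell_A=\mathbb N_0^{(A)}$ is the additive monoid of finitely supported functions $A\to\mathbb N_0$; $e_n$ ($n\in A$) is the element equal to $1$ at $n$ and $0$ elsewhere. A positive function $a:\ell_A\to\mathbb R$ ($a_\alpha>0$ for all $\alpha$) is admissible if $a_0=1$ and $a_{e_n}>1$ for all $n\in A$; an admissible $a$ is $d$-regular ($d\in\mathbb N$) if $\sum_{n\in A}\frac{1}{a_{e_n}^d-1}<\infty$. For $p\in\mathbb N$ let $\ell^2_{a^{-p}}=\{f=(f_\alpha)_{\alpha\in\ell_A}\in\mathbb C^{\ell_A}:\|f\|_p<\infty\}$ with $\|f\|_p=\big(\sum_{\alpha}|f_\alpha|^2a_\alpha^{-p}\big)^{1/2}$. The dual of $\mathcal F_a=\{(\varphi_\alpha):\sum_\alpha|\varphi_\alpha|^2a_\alpha^p<\infty\ \forall p\in\mathbb N\}$ is written $\mathcal F_a'=\bigcup_{p\in\mathbb N}\ell^2_{a^{-p}}$ and is called regular admissible if $a$ is admissible and $d$-regular for some $d\in\mathbb N$. The convolution of $f,g\in\mathbb C^{\ell_A}$ is $fg=\big(\sum_{\alpha+\beta=\gamma}f_\alpha g_\beta\big)_{\gamma\in\ell_A}$;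 its unit is $1=(\delta_{0,\alpha})_\alpha$. A regular admissible space $\mathcal F_a'$ is a Våge space if there is $e\in\mathbb N$ and finite positive numbers $A(k)$, $k\ge e$, such that for all $q\in\mathbb N$ and all $p\ge q+e$, $\|fg\|_p\le A(p-q)\|f\|_q\|g\|_p$ for all $f\in\ell^2_{a^{-q}}$ and $g\in\ell^2_{a^{-p}}$. A Våge space is closed under convolution. For $f=(f_\alpha)\in\mathcal R$, $E[f]=f_0\in\mathbb C$ is the coefficient at $\alpha=0$. *)

theory Defs
  imports "HOL-Library.Poly_Mapping" "HOL-Analysis.Infinite_Sum" "HOL-Algebra.Ring"
begin

text \<open>The additive monoid of finitely supported functions \<open>A \<rightarrow> \<nat>\<close>, realised inside
  \<^typ>\<open>nat \<Rightarrow>\<^sub>0 nat\<close>.\<close>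

definition multiindices :: "nat set \<Rightarrow> (nat \<Rightarrow>\<^sub>0 nat) set" where
  "multiindices A = {\<alpha>. Poly_Mapping.keys \<alpha> \<subseteq> A}"

definition admissible :: "nat set \<Rightarrow> ((nat \<Rightarrow>\<^sub>0 nat) \<Rightarrow> real) \<Rightarrow> bool" where
  "admissible A a \<longleftrightarrow>
     (\<forall>\<alpha>\<in>multiindices A. a \<alpha> > 0) \<and> a 0 = 1 \<and> (\<forall>n\<in>A. a (Poly_Mapping.single n 1) > 1)"

definition regular :: "nat set \<Rightarrow> ((nat \<Rightarrow>\<^sub>0 nat) \<Rightarrow> real) \<Rightarrow> nat \<Rightarrow> bool" where
  "regular A a d \<longleftrightarrow> (\<lambda>n. 1 / (a (Poly_Mapping.single n 1) ^ d - 1)) summable_on A"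

definition regular_admissible :: "nat set \<Rightarrow> ((nat \<Rightarrow>\<^sub>0 nat) \<Rightarrow> real) \<Rightarrow> bool" where
  "regular_admissible A a \<longleftrightarrow> admissible A a \<and> (\<exists>d\<ge>1. regular A a d)"

text \<open>Families indexed by \<^term>\<open>multiindices A\<close> are total functions that vanish
  outside \<^term>\<open>multiindices A\<close>, so that equality of families is equality of functions.\<close>

definition l2_neg ::
  "nat set \<Rightarrow> ((nat \<Rightarrow>\<^sub>0 nat) \<Rightarrow> real) \<Rightarrow> nat \<Rightarrow> ((nat \<Rightarrow>\<^sub>0 nat) \<Rightarrow> complex) set" where
  "l2_neg A a p = {f. (\<forall>\<alpha>. \<alpha> \<notin> multiindices A \<longrightarrow> f \<alpha> = 0) \<and>
     (\<lambda>\<alpha>. (cmod (f \<alpha>))\<^sup>2 / a \<alpha> ^ p) summable_on multiindices A}"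

text \<open>Meaningful only on \<^term>\<open>l2_neg A a p\<close>: the real-valued \<^const>\<open>infsum\<close> is \<open>0\<close>
  when the sum diverges.\<close>

definition norm_neg ::
  "nat set \<Rightarrow> ((nat \<Rightarrow>\<^sub>0 nat) \<Rightarrow> real) \<Rightarrow> nat \<Rightarrow> ((nat \<Rightarrow>\<^sub>0 nat) \<Rightarrow> complex) \<Rightarrow> real" where
  "norm_neg A a p f = sqrt (\<Sum>\<^sub>\<infinity>\<alpha>\<in>multiindices A. (cmod (f \<alpha>))\<^sup>2 / a \<alpha> ^ p)"

definition dual_space ::
  "nat set \<Rightarrow> ((nat \<Rightarrow>\<^sub>0 nat) \<Rightarrow> real) \<Rightarrow> ((nat \<Rightarrow>\<^sub>0 nat) \<Rightarrow> complex) set" where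
  "dual_space A a = (\<Union>p\<in>{1..}. l2_neg A a p)"

definition convolution ::
  "nat set \<Rightarrow> ((nat \<Rightarrow>\<^sub>0 nat) \<Rightarrow> complex) \<Rightarrow> ((nat \<Rightarrow>\<^sub>0 nat) \<Rightarrow> complex) \<Rightarrow>
     ((nat \<Rightarrow>\<^sub>0 nat) \<Rightarrow> complex)" where
  "convolution A f g = (\<lambda>\<gamma>.
     \<Sum>(\<alpha>, \<beta>)\<in>{(\<alpha>, \<beta>). \<alpha> \<in> multiindices A \<and> \<beta> \<in> multiindices A \<and> \<alpha> + \<beta> = \<gamma>}. f \<alpha> * g \<beta>)"

lemma finite_multiindex_decompositions:
  fixes \<gamma> :: "nat \<Rightarrow>\<^sub>0 nat"
  shows "finite {(\<alpha>, \<beta>). \<alpha> \<in> multiindices A \<and> \<beta> \<in> multiindices A \<and> \<alpha> + \<beta> = \<gamma>}"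
    (is "finite ?S")
proof -
  let ?B = "{f. \<forall>n. (n \<in> Poly_Mapping.keys \<gamma> \<longrightarrow> f n \<in> {..Max (Poly_Mapping.lookup \<gamma> ` Poly_Mapping.keys \<gamma>)}) \<and>
                   (n \<notin> Poly_Mapping.keys \<gamma> \<longrightarrow> f n = (0::nat))}"
  have fin: "finite ?B"
    by (rule finite_set_of_finite_funs) auto
  have bound: "Poly_Mapping.lookup \<alpha> \<in> ?B" if "\<alpha> + \<beta> = \<gamma>" for \<alpha> \<beta>
  proof -
    have le: "Poly_Mapping.lookup \<alpha> n \<le> Poly_Mapping.lookup \<gamma> n" for n
      using that by (auto simp: lookup_add)
    have "Poly_Mapping.lookup \<alpha> n \<le> Max (Poly_Mapping.lookup \<gamma> ` Poly_Mapping.keys \<gamma>)" if "n \<in> Poly_Mapping.keys \<gamma>" for n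
      using le[of n] that by (meson Max_ge finite_imageI finite_keys image_eqI le_trans)
    moreover have "Poly_Mapping.lookup \<alpha> n = 0" if "n \<notin> Poly_Mapping.keys \<gamma>" for n
      using le[of n] that by (simp add: in_keys_iff)
    ultimately show ?thesis by auto
  qed
  have "inj_on (\<lambda>(\<alpha>, \<beta>). Poly_Mapping.lookup \<alpha>) ?S"
    by (auto simp: inj_on_def lookup_inject)
  moreover have "(\<lambda>(\<alpha>, \<beta>). Poly_Mapping.lookup \<alpha>) ` ?S \<subseteq> ?B"
    unfolding image_subset_iff case_prod_beta
    by (rule ballI, rule bound) auto
  ultimately show ?thesis
    using fin by (meson finite_imageD finite_subset)
qed

text \<open>The estimate \<open>\<parallel>fg\<parallel>\<^sub>p \<le> A(p - q) \<parallel>f\<parallel>\<^sub>q \<parallel>g\<parallel>\<^sub>p\<close> is between extended nonnegative reals, so it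
  includes that \<open>\<parallel>fg\<parallel>\<^sub>p\<close> is finite; with a real-valued norm this is stated separately.\<close>

definition vage_space :: "nat set \<Rightarrow> ((nat \<Rightarrow>\<^sub>0 nat) \<Rightarrow> real) \<Rightarrow> bool" where
  "vage_space A a \<longleftrightarrow> regular_admissible A a \<and>
     (\<exists>e\<ge>1. \<exists>C :: nat \<Rightarrow> real. (\<forall>k\<ge>e. C k > 0) \<and>
       (\<forall>q\<ge>1. \<forall>p\<ge>q + e. \<forall>f\<in>l2_neg A a q. \<forall>g\<in>l2_neg A a p.
          convolution A f g \<in> l2_neg A a p \<and>
          norm_neg A a p (convolution A f g) \<le> C (p - q) * norm_neg A a q f * norm_neg A a p g))"

definition dual_ring ::
  "nat set \<Rightarrow> ((nat \<Rightarrow>\<^sub>0 nat) \<Rightarrow> real) \<Rightarrow> ((nat \<Rightarrow>\<^sub>0 nat) \<Rightarrow> complex) ring" where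
  "dual_ring A a =
     \<lparr>carrier = dual_space A a,
      mult = convolution A,
      one = (\<lambda>\<alpha>. if \<alpha> = 0 then 1 else 0),
      zero = (\<lambda>\<alpha>. 0),
      add = (\<lambda>f g \<alpha>. f \<alpha> + g \<alpha>)\<rparr>"

definition expectation :: "((nat \<Rightarrow>\<^sub>0 nat) \<Rightarrow> complex) \<Rightarrow> complex" where
  "expectation f = f 0"

end

theory Submission imports Defs begin

text \<open>Writing \<open>f = c (1 - h)\<close> with \<open>c = E[f]\<close> and \<open>h\<^sub>0 = 0\<close>, one needs \<open>g = 1 + h g\<close> in the space.
  The Vage inequality on unit vectors, as \<open>q \<rightarrow> \<infinity>\<close> with \<open>p - q\<close> fixed, forces
  \<open>a\<^sub>\<alpha> a\<^sub>\<beta> \<le> a\<^bsub>\<alpha>+\<beta>\<^esub>\<close>; regularity then bounds \<open>a\<close> away from \<open>1\<close> off \<open>0\<close>, so \<open>\<parallel>h\<parallel>\<^sub>q\<close> is as small as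
  desired for large \<open>q\<close>. Hence \<open>g \<mapsto> 1 + h g\<close> preserves a ball of \<open>\<parallel>\<cdot>\<parallel>\<^sub>p\<close>, \<open>p = q + e\<close>, and its
  iterates are eventually constant in every coordinate because \<open>h\<^sub>0 = 0\<close>.\<close>

section \<open>Total degree and the monoid of multi-indices\<close>

definition total_degree :: "('a \<Rightarrow>\<^sub>0 nat) \<Rightarrow> nat" where
  "total_degree \<gamma> = Sum_any (Poly_Mapping.lookup \<gamma>)"

text \<open>Additivity makes the degree a grading. It serves both as an induction measure on
  multi-indices and as the order in which the coefficients of the inverse become determined.\<close>

lemma total_degree_add: "total_degree (\<alpha> + \<beta>) = total_degree \<alpha> + total_degree \<beta>"
  unfolding total_degree_def lookup_add
  by (intro Sum_any.distrib) (auto intro: finite_lookup)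

lemma lookup_le_total_degree: "Poly_Mapping.lookup \<gamma> n \<le> total_degree \<gamma>"
proof (cases "n \<in> Poly_Mapping.keys \<gamma>")
  case True
  then have "Poly_Mapping.lookup \<gamma> n \<le> (\<Sum>k\<in>Poly_Mapping.keys \<gamma>. Poly_Mapping.lookup \<gamma> k)"
    by (intro member_le_sum) auto
  also have "\<dots> = total_degree \<gamma>"
    unfolding total_degree_def by (rule Sum_any.expand_superset[symmetric]) (auto simp: in_keys_iff)
  finally show ?thesis .
qed (simp add: in_keys_iff)

lemma total_degree_pos:
  assumes "\<gamma> \<noteq> 0"
  shows "0 < total_degree \<gamma>"
proof -
  obtain n where "n \<in> Poly_Mapping.keys \<gamma>"
    using assms by fastforce
  then show ?thesis
    using lookup_le_total_degree[of \<gamma> n] by (simp add: in_keys_iff)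
qed

lemma zero_in_multiindices: "0 \<in> multiindices A"
  by (simp add: multiindices_def)

text \<open>Natural-number entries cannot cancel, so the support of a sum is the union of the
  supports.\<close>

lemma add_in_multiindices_iff:
  "\<alpha> + \<beta> \<in> multiindices A \<longleftrightarrow> \<alpha> \<in> multiindices A \<and> \<beta> \<in> multiindices A"
  by (auto simp: multiindices_def in_keys_iff lookup_add subset_iff)

lemma nonzero_multiindexE:
  assumes "\<alpha> \<in> multiindices A" "\<alpha> \<noteq> 0"
  obtains n \<beta> where "n \<in> A" "\<beta> \<in> multiindices A" "\<alpha> = Poly_Mapping.single n 1 + \<beta>"
proof -
  obtain n where n: "n \<in> Poly_Mapping.keys \<alpha>"
    using assms(2) by (metis all_not_in_conv keys_eq_empty)
  \<comment> \<open>The subtraction on naturals is truncated, but it is exact here because the entry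
    of \<alpha> at \<open>n\<close> is at least 1.\<close>
  define \<beta> where "\<beta> = \<alpha> - Poly_Mapping.single n 1"
  have eq: "\<alpha> = Poly_Mapping.single n 1 + \<beta>"
    using n by (intro poly_mapping_eqI)
      (auto simp: \<beta>_def lookup_add lookup_minus lookup_single when_def in_keys_iff)
  show thesis
    using that[OF _ _ eq] n assms(1) eq add_in_multiindices_iff[of _ \<beta> A]
    by (auto simp: multiindices_def)
qed

section \<open>Convolution and unit vectors\<close>

lemma convolution_commute: "convolution A f g = convolution A g f"
  unfolding convolution_def
  by (intro ext sum.reindex_bij_witness[of _ prod.swap prod.swap]) (auto simp: add.commute)

text \<open>By additivity of the degree, 0 decomposes only as 0 + 0. Thus the expectation is
  multiplicative, which gives the easy direction of the theorem.\<close>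

lemma convolution_at_zero: "convolution A f g 0 = f 0 * g 0"
proof -
  have eq: "\<alpha> = 0 \<and> \<beta> = 0" if "\<alpha> + \<beta> = 0" for \<alpha> \<beta> :: "nat \<Rightarrow>\<^sub>0 nat"
  proof -
    have "total_degree \<alpha> + total_degree \<beta> = 0"
      using total_degree_add[of \<alpha> \<beta>] that by (simp add: total_degree_def)
    then show ?thesis
      using total_degree_pos[of \<alpha>] total_degree_pos[of \<beta>] by auto
  qed
  have "{(\<alpha>, \<beta>). \<alpha> \<in> multiindices A \<and> \<beta> \<in> multiindices A \<and> \<alpha> + \<beta> = 0} = {(0, 0)}"
    by (auto simp: zero_in_multiindices dest: eq)
  then show ?thesis
    by (simp add: convolution_def)
qed

text \<open>Pairs with \<alpha> = 0 contribute nothing because \<open>h 0 = 0\<close>, and all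
  others have \<beta> of strictly smaller degree. So the equation g = 1 + h g is triangular with
  respect to degree.\<close>

lemma convolution_lower_cong:
  assumes "h 0 = 0" "\<And>\<beta>. total_degree \<beta> < total_degree \<gamma> \<Longrightarrow> g \<beta> = g' \<beta>"
  shows "convolution A h g \<gamma> = convolution A h g' \<gamma>"
  unfolding convolution_def
proof (rule sum.cong, goal_cases)
  case (2 x)
  then obtain \<alpha> \<beta> where x: "x = (\<alpha>, \<beta>)" "\<alpha> + \<beta> = \<gamma>" by auto
  show ?case
  proof (cases "\<alpha> = 0")
    case False
    then have "total_degree \<beta> < total_degree \<gamma>"
      using x total_degree_pos[of \<alpha>] total_degree_add[of \<alpha> \<beta>] by simp
    then show ?thesis using assms(2) x by simp
  qed (use assms(1) x in simp)
qed simp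

definition unit_vec :: "(nat \<Rightarrow>\<^sub>0 nat) \<Rightarrow> (nat \<Rightarrow>\<^sub>0 nat) \<Rightarrow> complex" where
  "unit_vec \<alpha> = (\<lambda>\<gamma>. if \<gamma> = \<alpha> then 1 else 0)"

lemma convolution_unit_vec:
  assumes "\<alpha> \<in> multiindices A" "\<beta> \<in> multiindices A"
  shows "convolution A (unit_vec \<alpha>) (unit_vec \<beta>) = unit_vec (\<alpha> + \<beta>)"
proof
  fix \<gamma>
  let ?S = "{(\<alpha>, \<beta>). \<alpha> \<in> multiindices A \<and> \<beta> \<in> multiindices A \<and> \<alpha> + \<beta> = \<gamma>}"
  have "convolution A (unit_vec \<alpha>) (unit_vec \<beta>) \<gamma> = (\<Sum>x\<in>?S. if x = (\<alpha>, \<beta>) then 1 else 0)"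
    unfolding convolution_def by (intro sum.cong) (auto simp: unit_vec_def split: if_splits)
  also have "\<dots> = unit_vec (\<alpha> + \<beta>) \<gamma>"
    using finite_multiindex_decompositions[of A \<gamma>] assms by (auto simp: unit_vec_def)
  finally show "convolution A (unit_vec \<alpha>) (unit_vec \<beta>) \<gamma> = unit_vec (\<alpha> + \<beta>) \<gamma>" .
qed

text \<open>Outside \<open>multiindices A\<close> the convolution is an empty sum, so agreement
  there rests on the vanishing assumption.\<close>

lemma convolution_one_left:
  assumes "\<And>\<alpha>. \<alpha> \<notin> multiindices A \<Longrightarrow> g \<alpha> = 0"
  shows "convolution A (unit_vec 0) g = g"
proof
  fix \<gamma>
  let ?S = "{(\<alpha>, \<beta>). \<alpha> \<in> multiindices A \<and> \<beta> \<in> multiindices A \<and> \<alpha> + \<beta> = \<gamma>}"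
  have "convolution A (unit_vec 0) g \<gamma> = (\<Sum>x\<in>?S. if x = (0, \<gamma>) then g \<gamma> else 0)"
    unfolding convolution_def by (intro sum.cong) (auto simp: unit_vec_def split: if_splits)
  also have "\<dots> = g \<gamma>"
    using finite_multiindex_decompositions[of A \<gamma>] assms by (auto simp: zero_in_multiindices)
  finally show "convolution A (unit_vec 0) g \<gamma> = g \<gamma>" .
qed

lemma convolution_diff_left:
  "convolution A (\<lambda>\<alpha>. f \<alpha> - h \<alpha>) g \<gamma> = convolution A f g \<gamma> - convolution A h g \<gamma>"
  by (simp add: convolution_def sum_subtractf[symmetric] case_prod_beta algebra_simps)

lemma convolution_scale:
  "convolution A (\<lambda>\<alpha>. c * f \<alpha>) (\<lambda>\<alpha>. d * g \<alpha>) \<gamma> = c * d * convolution A f g \<gamma>"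
  by (simp add: convolution_def sum_distrib_left case_prod_beta algebra_simps)

lemma unit_vec_has_sum:
  assumes "\<alpha> \<in> multiindices A"
  shows "((\<lambda>\<gamma>. (cmod (unit_vec \<alpha> \<gamma>))\<^sup>2 / a \<gamma> ^ p) has_sum (1 / a \<alpha> ^ p)) (multiindices A)"
proof -
  let ?s = "\<lambda>\<gamma>. (cmod (unit_vec \<alpha> \<gamma>))\<^sup>2 / a \<gamma> ^ p"
  have "(?s has_sum (1 / a \<alpha> ^ p)) {\<alpha>}"
    by (rule has_sum_finiteI) (auto simp: unit_vec_def)
  also have "?this \<longleftrightarrow> ?thesis"
    by (rule has_sum_cong_neutral) (use assms in \<open>auto simp: unit_vec_def\<close>)
  finally show ?thesis .
qed

lemma unit_vec_in_l2_neg: "\<alpha> \<in> multiindices A \<Longrightarrow> unit_vec \<alpha> \<in> l2_neg A a p"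
  using unit_vec_has_sum[of \<alpha> A a p] has_sum_imp_summable
  by (fastforce simp: l2_neg_def unit_vec_def)

lemma norm_neg_unit_vec: "\<alpha> \<in> multiindices A \<Longrightarrow> norm_neg A a p (unit_vec \<alpha>) = sqrt (1 / a \<alpha> ^ p)"
  unfolding norm_neg_def using unit_vec_has_sum infsumI by fastforce

section \<open>Growth of the weight forced by the Vage inequality\<close>

lemma le_one_if_powers_bounded:
  fixes x :: real
  assumes "\<And>q. q \<ge> 1 \<Longrightarrow> x ^ q \<le> K"
  shows "x \<le> 1"
proof (rule ccontr)
  assume "\<not> x \<le> 1"
  then have x: "1 < x" by simp
  obtain n where "K < x ^ n"
    using real_arch_pow[OF x] by blast
  \<comment> \<open>The exponent is raised by one because the bound is assumed only from exponent 1
    on, while \<open>n\<close> may be 0.\<close>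
  also have "\<dots> \<le> x ^ Suc n" using x by (intro power_increasing) auto
  finally show False using assms[of "Suc n"] by simp
qed

lemma norm_neg_nonneg:
  assumes "admissible A a"
  shows "0 \<le> norm_neg A a p f"
  using assms unfolding norm_neg_def admissible_def
  by (intro real_sqrt_ge_zero infsum_nonneg divide_nonneg_pos) auto

lemma norm_neg_square:
  assumes "admissible A a"
  shows "(norm_neg A a p f)\<^sup>2 = (\<Sum>\<^sub>\<infinity>\<alpha>\<in>multiindices A. (cmod (f \<alpha>))\<^sup>2 / a \<alpha> ^ p)"
  unfolding norm_neg_def using assms
  by (intro real_sqrt_pow2 infsum_nonneg) (auto simp: admissible_def less_imp_le)

text \<open>With p = q + e the constant in the inequality is always \<open>C e\<close>. Applied to
  unit vectors, the inequality bounds all powers of a single ratio by one number, so the ratio is at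
  most 1.\<close>

lemma vage_space_supermultiplicative:
  assumes "vage_space A a" "\<alpha> \<in> multiindices A" "\<beta> \<in> multiindices A"
  shows "a \<alpha> * a \<beta> \<le> a (\<alpha> + \<beta>)"
proof -
  from assms(1) have adm: "admissible A a"
    by (auto simp: vage_space_def regular_admissible_def)
  obtain e C where vage: "\<forall>q\<ge>1. \<forall>p\<ge>q + e. \<forall>f\<in>l2_neg A a q. \<forall>g\<in>l2_neg A a p.
      convolution A f g \<in> l2_neg A a p \<and>
      norm_neg A a p (convolution A f g) \<le> C (p - q) * norm_neg A a q f * norm_neg A a p g"
    using assms(1) unfolding vage_space_def by blast
  have sum_in: "\<alpha> + \<beta> \<in> multiindices A"
    using assms by (simp add: add_in_multiindices_iff)
  have pos: "a \<alpha> > 0" "a \<beta> > 0" "a (\<alpha> + \<beta>) > 0"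
    using adm assms sum_in by (auto simp: admissible_def)
  \<comment> \<open>This collects what is left of the squared inequality once all q-th powers are on
    the other side; it does not depend on \<open>q\<close>.\<close>
  let ?K = "(C e)\<^sup>2 * (a (\<alpha> + \<beta>) / a \<beta>) ^ e"
  have "(a \<alpha> * a \<beta> / a (\<alpha> + \<beta>)) ^ q \<le> ?K" if "q \<ge> 1" for q
  proof -
    have "sqrt (1 / a (\<alpha> + \<beta>) ^ (q + e)) \<le> C e * sqrt (1 / a \<alpha> ^ q) * sqrt (1 / a \<beta> ^ (q + e))"
      using vage[rule_format, OF that order.refl, of "unit_vec \<alpha>" "unit_vec \<beta>"] assms sum_in
      by (simp add: unit_vec_in_l2_neg convolution_unit_vec norm_neg_unit_vec)
    then have "(sqrt (1 / a (\<alpha> + \<beta>) ^ (q + e)))\<^sup>2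
        \<le> (C e * sqrt (1 / a \<alpha> ^ q) * sqrt (1 / a \<beta> ^ (q + e)))\<^sup>2"
      using pos by (intro power_mono) auto
    then have "1 / a (\<alpha> + \<beta>) ^ (q + e) \<le> (C e)\<^sup>2 * (1 / a \<alpha> ^ q) * (1 / a \<beta> ^ (q + e))"
      using pos by (simp add: power_mult_distrib)
    then have "a \<alpha> ^ q * a \<beta> ^ (q + e) \<le> (C e)\<^sup>2 * a (\<alpha> + \<beta>) ^ (q + e)"
      using pos by (simp add: field_simps)
    then show ?thesis
      using pos by (simp add: field_simps power_add)
  qed
  then have "a \<alpha> * a \<beta> / a (\<alpha> + \<beta>) \<le> 1"
    by (rule le_one_if_powers_bounded)
  then show ?thesis using pos by simp
qed

text \<open>Induction on the degree: each step splits off one generator, whose weight exceeds 1, and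
  applies supermultiplicativity.\<close>

lemma vage_space_ge_one:
  assumes "vage_space A a" "\<alpha> \<in> multiindices A"
  shows "1 \<le> a \<alpha>"
  using assms(2)
proof (induction "total_degree \<alpha>" arbitrary: \<alpha> rule: less_induct)
  case less
  have adm: "admissible A a"
    using assms(1) by (auto simp: vage_space_def regular_admissible_def)
  show ?case
  proof (cases "\<alpha> = 0")
    case False
    then obtain n \<beta> where n: "n \<in> A" "\<beta> \<in> multiindices A" "\<alpha> = Poly_Mapping.single n 1 + \<beta>"
      using nonzero_multiindexE less.prems by metis
    have "Poly_Mapping.single n 1 \<noteq> (0 :: nat \<Rightarrow>\<^sub>0 nat)"
      by (metis lookup_single_eq lookup_zero zero_neq_one)
    then have "1 \<le> a \<beta>"
      using n total_degree_pos[of "Poly_Mapping.single n (1 :: nat)"] by (intro less.hyps) (auto simp: total_degree_add)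
    moreover have "1 < a (Poly_Mapping.single n 1)"
      using adm n by (simp add: admissible_def)
    ultimately have "1 * 1 \<le> a (Poly_Mapping.single n 1) * a \<beta>"
      by (intro mult_mono) auto
    also have "\<dots> \<le> a \<alpha>"
      unfolding n(3) using less.prems n
      by (intro vage_space_supermultiplicative[OF assms(1)]) (auto simp: add_in_multiindices_iff)
    finally show ?thesis by simp
  qed (use adm in \<open>simp add: admissible_def\<close>)
qed

text \<open>Each term of the convergent regularity series is bounded by the whole sum, which keeps
  the d-th powers of the generator weights uniformly away from 1. Any nonzero index has a weight at
  least that of some generator.\<close>

lemma vage_space_gap:
  assumes "vage_space A a"
  obtains d r where "r > 1" "\<And>\<alpha>. \<alpha> \<in> multiindices A \<Longrightarrow> \<alpha> \<noteq> 0 \<Longrightarrow> r \<le> a \<alpha> ^ d"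
proof -
  obtain d where adm: "admissible A a" and d: "d \<ge> 1"
    and summ: "(\<lambda>n. 1 / (a (Poly_Mapping.single n 1) ^ d - 1)) summable_on A"
    using assms by (auto simp: vage_space_def regular_admissible_def regular_def)
  define t where "t = (\<lambda>n. 1 / (a (Poly_Mapping.single n 1) ^ d - 1))"
  \<comment> \<open>The added 1 keeps \<open>S\<close> positive even when \<open>A\<close> is
    empty.\<close>
  define S where "S = infsum t A + 1"
  have gt: "a (Poly_Mapping.single n 1) ^ d > 1" if "n \<in> A" for n
    using adm that d by (intro one_less_power) (auto simp: admissible_def)
  have t_pos: "t n > 0" if "n \<in> A" for n
    using gt[OF that] by (simp add: t_def)
  have "infsum t A \<ge> 0"
    using t_pos by (intro infsum_nonneg) (auto simp: less_imp_le)
  then have S: "S > 0" by (simp add: S_def)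
  have *: "1 + 1 / S \<le> a (Poly_Mapping.single n 1) ^ d" if "n \<in> A" for n
  proof -
    have "sum t {n} \<le> infsum t A"
      using summ[folded t_def] t_pos that by (intro finite_sum_le_infsum) (auto simp: less_imp_le)
    then have "t n \<le> S" by (simp add: S_def)
    then show ?thesis
      using gt[OF that] S by (simp add: t_def field_simps)
  qed
  show thesis
  proof (rule that[of "1 + 1 / S" d])
    fix \<alpha> assume "\<alpha> \<in> multiindices A" "\<alpha> \<noteq> 0"
    then obtain n \<beta> where n: "n \<in> A" "\<beta> \<in> multiindices A" "\<alpha> = Poly_Mapping.single n 1 + \<beta>"
      using nonzero_multiindexE by metis
    have s: "a (Poly_Mapping.single n 1) > 1"
      using adm n by (simp add: admissible_def)
    have "a (Poly_Mapping.single n 1) * 1 \<le> a (Poly_Mapping.single n 1) * a \<beta>"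
      using vage_space_ge_one[OF assms n(2)] s by (intro mult_left_mono) auto
    also have "\<dots> \<le> a \<alpha>"
      unfolding n(3) using \<open>\<alpha> \<in> multiindices A\<close> n
      by (intro vage_space_supermultiplicative[OF assms]) (auto simp: add_in_multiindices_iff)
    finally have "a (Poly_Mapping.single n 1) ^ d \<le> a \<alpha> ^ d"
      using s by (intro power_mono) auto
    then show "1 + 1 / S \<le> a \<alpha> ^ d" using *[OF n(1)] by linarith
  qed (use S in simp)
qed

text \<open>Raising the exponent by \<open>d * m\<close> shrinks every summand off 0 by at least the
  factor \<open>r ^ m\<close>. The summand at 0 would not shrink, since \<open>a 0 = 1\<close>, but
  it vanishes by \<open>h 0 = 0\<close>.\<close>

lemma vage_space_norm_small:
  assumes vage: "vage_space A a" and h: "h \<in> l2_neg A a q" "h 0 = 0" and "\<epsilon> > 0"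
  obtains q' where "q' \<ge> q" "h \<in> l2_neg A a q'" "(norm_neg A a q' h)\<^sup>2 < \<epsilon>"
proof -
  have adm: "admissible A a"
    using vage by (auto simp: vage_space_def regular_admissible_def)
  obtain d r where r: "r > 1" "\<And>\<alpha>. \<alpha> \<in> multiindices A \<Longrightarrow> \<alpha> \<noteq> 0 \<Longrightarrow> r \<le> a \<alpha> ^ d"
    using vage_space_gap[OF vage] by metis
  let ?N = "(norm_neg A a q h)\<^sup>2"
  obtain m where m: "?N / \<epsilon> < r ^ m"
    using real_arch_pow[OF r(1)] by blast
  let ?q = "q + d * m"
  let ?s = "\<lambda>p \<alpha>. (cmod (h \<alpha>))\<^sup>2 / a \<alpha> ^ p"
  have summ: "?s q summable_on multiindices A"
    using h(1) by (simp add: l2_neg_def)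
  then have summ': "(\<lambda>\<alpha>. ?s q \<alpha> * (1 / r ^ m)) summable_on multiindices A"
    by (rule summable_on_cmult_left)
  have le: "?s ?q \<alpha> \<le> ?s q \<alpha> * (1 / r ^ m)" if "\<alpha> \<in> multiindices A" for \<alpha>
  proof (cases "\<alpha> = 0")
    case False
    have pos: "a \<alpha> > 0" using adm that by (simp add: admissible_def)
    have "r ^ m \<le> (a \<alpha> ^ d) ^ m"
      using r(1) r(2)[OF that False] by (intro power_mono) auto
    then have "1 / (a \<alpha> ^ d) ^ m \<le> 1 / r ^ m"
      using r(1) pos by (intro divide_left_mono) auto
    then have "?s q \<alpha> * (1 / (a \<alpha> ^ d) ^ m) \<le> ?s q \<alpha> * (1 / r ^ m)"
      using pos by (intro mult_left_mono) auto
    then show ?thesis by (simp add: power_add power_mult)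
  qed (simp add: h(2))
  have nonneg: "0 \<le> ?s p \<alpha>" if "\<alpha> \<in> multiindices A" for p \<alpha>
    using adm that by (simp add: admissible_def less_imp_le)
  have summ_q: "?s ?q summable_on multiindices A"
    by (rule summable_on_comparison_test[OF summ']) (use le nonneg in auto)
  have "(norm_neg A a ?q h)\<^sup>2 \<le> (\<Sum>\<^sub>\<infinity>\<alpha>\<in>multiindices A. ?s q \<alpha> * (1 / r ^ m))"
    unfolding norm_neg_square[OF adm] by (rule infsum_mono[OF summ_q summ' le])
  also have "\<dots> = ?N * (1 / r ^ m)"
    unfolding norm_neg_square[OF adm] by (rule infsum_cmult_left) (use summ in auto)
  also have "\<dots> < \<epsilon>"
    using m r(1) \<open>\<epsilon> > 0\<close> by (simp add: field_simps)
  finally have "(norm_neg A a ?q h)\<^sup>2 < \<epsilon>" .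
  then show thesis
    using that[of ?q] h(1) summ_q by (simp add: l2_neg_def)
qed

section \<open>The Neumann iteration and its limit\<close>

lemma norm_neg_one_plus:
  assumes adm: "admissible A a" and u: "u \<in> l2_neg A a p" "u 0 = 0"
  shows "(\<lambda>\<gamma>. unit_vec 0 \<gamma> + u \<gamma>) \<in> l2_neg A a p"
    and "(norm_neg A a p (\<lambda>\<gamma>. unit_vec 0 \<gamma> + u \<gamma>))\<^sup>2 = 1 + (norm_neg A a p u)\<^sup>2"
proof -
  let ?s = "\<lambda>w \<gamma>. (cmod (w \<gamma>))\<^sup>2 / a \<gamma> ^ p"
  have "((\<lambda>\<gamma>. ?s (unit_vec 0) \<gamma> + ?s u \<gamma>) has_sum 1 / a 0 ^ p + (norm_neg A a p u)\<^sup>2) (multiindices A)"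
    unfolding norm_neg_square[OF adm] using u(1)
    by (intro has_sum_add unit_vec_has_sum zero_in_multiindices has_sum_infsum) (simp add: l2_neg_def)
  \<comment> \<open>At every \<gamma> at most one of the two families is nonzero, so there is no
    cross term.\<close>
  moreover have "(\<lambda>\<gamma>. ?s (unit_vec 0) \<gamma> + ?s u \<gamma>) = ?s (\<lambda>\<gamma>. unit_vec 0 \<gamma> + u \<gamma>)"
    using u(2) by (auto simp: unit_vec_def)
  ultimately have *: "(?s (\<lambda>\<gamma>. unit_vec 0 \<gamma> + u \<gamma>) has_sum 1 + (norm_neg A a p u)\<^sup>2) (multiindices A)"
    using adm by (simp add: admissible_def)
  then show "(\<lambda>\<gamma>. unit_vec 0 \<gamma> + u \<gamma>) \<in> l2_neg A a p"
    using has_sum_imp_summable[OF *] u(1) zero_in_multiindices[of A] by (auto simp: l2_neg_def unit_vec_def)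
  show "(norm_neg A a p (\<lambda>\<gamma>. unit_vec 0 \<gamma> + u \<gamma>))\<^sup>2 = 1 + (norm_neg A a p u)\<^sup>2"
    unfolding norm_neg_square[OF adm] using infsumI[OF *] by (simp add: norm_neg_square[OF adm])
qed

text \<open>Formally these are the partial sums of the geometric series for the inverse of 1 - h,
  written as iterates so that no convolution powers are needed.\<close>

primrec neumann :: "nat set \<Rightarrow> ((nat \<Rightarrow>\<^sub>0 nat) \<Rightarrow> complex) \<Rightarrow> nat \<Rightarrow> (nat \<Rightarrow>\<^sub>0 nat) \<Rightarrow> complex" where
  "neumann A h 0 = (\<lambda>\<gamma>. 0)"
| "neumann A h (Suc N) = (\<lambda>\<gamma>. unit_vec 0 \<gamma> + convolution A h (neumann A h N) \<gamma>)"

text \<open>Agreement of consecutive iterates in degrees below N passes to degrees below N + 1,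
  since convolution with \<open>h\<close> reads only strictly lower degrees.\<close>

lemma neumann_stable_Suc:
  assumes "h 0 = 0" "total_degree \<gamma> < N"
  shows "neumann A h (Suc N) \<gamma> = neumann A h N \<gamma>"
  using assms(2)
proof (induction N arbitrary: \<gamma>)
  case (Suc N)
  have "convolution A h (neumann A h (Suc N)) \<gamma> = convolution A h (neumann A h N) \<gamma>"
    using Suc by (intro convolution_lower_cong assms(1)) auto
  then show ?case by simp
qed simp

lemma neumann_stable:
  assumes "h 0 = 0" "total_degree \<gamma> < M" "M \<le> N"
  shows "neumann A h N \<gamma> = neumann A h M \<gamma>"
  using assms(3)
proof (induction N rule: dec_induct)
  case (step N)
  then show ?case using neumann_stable_Suc[of h, OF assms(1), of \<gamma> N A] assms(2) by simp
qed simp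

text \<open>The bound reproduces itself: h g vanishes at 0, so it is orthogonal to the unit and the
  next squared norm is at most 1 + 2/2 = 2.\<close>

lemma neumann_norm_le:
  assumes adm: "admissible A a"
    and contr: "\<And>g. g \<in> l2_neg A a p \<Longrightarrow> convolution A h g \<in> l2_neg A a p \<and>
      (norm_neg A a p (convolution A h g))\<^sup>2 \<le> (norm_neg A a p g)\<^sup>2 / 2"
    and "h 0 = 0"
  shows "neumann A h N \<in> l2_neg A a p \<and> (norm_neg A a p (neumann A h N))\<^sup>2 \<le> 2"
proof (induction N)
  case 0
  show ?case by (simp add: l2_neg_def norm_neg_def)
next
  case (Suc N)
  have "convolution A h (neumann A h N) 0 = 0"
    by (simp add: convolution_at_zero assms(3))
  then show ?case
    using contr[of "neumann A h N"] Suc norm_neg_one_plus[OF adm, of "convolution A h (neumann A h N)" p]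
    by simp
qed

text \<open>The limit is taken coordinatewise, and the uniform norm bound on the iterates passes to
  it through finite partial sums, in the manner of Fatou's lemma.\<close>

lemma vage_space_one_minus_invertible:
  assumes vage: "vage_space A a" and h: "h \<in> dual_space A a" "h 0 = 0"
  obtains g where "g \<in> dual_space A a" "\<And>\<gamma>. g \<gamma> = unit_vec 0 \<gamma> + convolution A h g \<gamma>"
proof -
  have adm: "admissible A a"
    using vage by (auto simp: vage_space_def regular_admissible_def)
  obtain e C where Ce: "C e > 0"
    and ineq: "\<forall>q\<ge>1. \<forall>p\<ge>q + e. \<forall>f\<in>l2_neg A a q. \<forall>g\<in>l2_neg A a p.
      convolution A f g \<in> l2_neg A a p \<and>
      norm_neg A a p (convolution A f g) \<le> C (p - q) * norm_neg A a q f * norm_neg A a p g"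
    using vage unfolding vage_space_def by (metis order.refl)
  obtain q0 where q0: "q0 \<ge> 1" "h \<in> l2_neg A a q0"
    using h(1) by (auto simp: dual_space_def)
  \<comment> \<open>This threshold makes the square of \<open>C e * norm_neg A a q h\<close> at most
    1/2, which is the contraction factor below.\<close>
  obtain q where q: "q \<ge> q0" "h \<in> l2_neg A a q" "(norm_neg A a q h)\<^sup>2 < 1 / (2 * (C e)\<^sup>2)"
    using vage_space_norm_small[OF vage q0(2) h(2), of "1 / (2 * (C e)\<^sup>2)"] Ce by auto
  \<comment> \<open>The difference \<open>p - q\<close> is \<open>e\<close> however large
    \<open>q\<close> had to be, so the constant \<open>C e\<close> fixed beforehand still
    applies.\<close>
  define p where "p = q + e"
  have contr: "convolution A h g \<in> l2_neg A a p \<and>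
      (norm_neg A a p (convolution A h g))\<^sup>2 \<le> (norm_neg A a p g)\<^sup>2 / 2"
    if g: "g \<in> l2_neg A a p" for g
  proof -
    have v: "convolution A h g \<in> l2_neg A a p"
      "norm_neg A a p (convolution A h g) \<le> C e * norm_neg A a q h * norm_neg A a p g"
      using ineq[rule_format, of q p h g] q q0 g by (auto simp: p_def)
    have "(norm_neg A a p (convolution A h g))\<^sup>2 \<le> (C e * norm_neg A a q h * norm_neg A a p g)\<^sup>2"
      by (intro power_mono v norm_neg_nonneg adm)
    also have "\<dots> = ((C e)\<^sup>2 * (norm_neg A a q h)\<^sup>2) * (norm_neg A a p g)\<^sup>2"
      by (simp add: power_mult_distrib)
    also have "\<dots> \<le> (1 / 2) * (norm_neg A a p g)\<^sup>2"
      using q(3) Ce by (intro mult_right_mono) (auto simp: field_simps)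
    finally show ?thesis using v by simp
  qed
  note bound = neumann_norm_le[where h = h, OF adm contr h(2)]
  \<comment> \<open>The index is the first one from which stability guarantees that the coordinate
    at \<gamma> no longer changes.\<close>
  define g where "g = (\<lambda>\<gamma>. neumann A h (Suc (total_degree \<gamma>)) \<gamma>)"
  have g_eq: "g \<gamma> = neumann A h N \<gamma>" if "total_degree \<gamma> < N" for \<gamma> N
    using neumann_stable[of h, OF h(2), of \<gamma> "Suc (total_degree \<gamma>)" N A] that by (simp add: g_def)
  have fixpoint: "g \<gamma> = unit_vec 0 \<gamma> + convolution A h g \<gamma>" for \<gamma>
  proof -
    \<comment> \<open>One iterate fewer suffices here, because only degrees strictly below that of
      \<gamma> enter.\<close>
    have "convolution A h g \<gamma> = convolution A h (neumann A h (total_degree \<gamma>)) \<gamma>"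
      by (intro convolution_lower_cong h(2) g_eq)
    then show ?thesis by (simp add: g_def)
  qed
  let ?s = "\<lambda>w \<gamma>. (cmod (w \<gamma>))\<^sup>2 / a \<gamma> ^ p"
  have nonneg: "0 \<le> ?s w \<gamma>" if "\<gamma> \<in> multiindices A" for w \<gamma>
    using adm that by (simp add: admissible_def less_imp_le)
  have "?s g summable_on multiindices A"
  proof (rule nonneg_bdd_above_summable_on)
    show "bdd_above (sum (?s g) ` {F. F \<subseteq> multiindices A \<and> finite F})"
    proof (rule bdd_aboveI2)
      fix F assume "F \<in> {F. F \<subseteq> multiindices A \<and> finite F}"
      then have F: "F \<subseteq> multiindices A" "finite F" by auto
      \<comment> \<open>This exceeds the degree of every index in \<open>F\<close>, so a single
        iterate agrees with \<open>g\<close> on all of \<open>F\<close>.\<close>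
      define N where "N = Suc (\<Sum>\<gamma>\<in>F. total_degree \<gamma>)"
      have "g \<gamma> = neumann A h N \<gamma>" if "\<gamma> \<in> F" for \<gamma>
        using member_le_sum[of \<gamma> F total_degree] F that by (intro g_eq) (simp add: N_def)
      then have "sum (?s g) F = sum (?s (neumann A h N)) F"
        by (intro sum.cong) simp_all
      also have "\<dots> \<le> (norm_neg A a p (neumann A h N))\<^sup>2"
        unfolding norm_neg_square[OF adm] using bound[of N] F nonneg
        by (intro finite_sum_le_infsum) (auto simp: l2_neg_def)
      also have "\<dots> \<le> 2" using bound[of N] by simp
      finally show "sum (?s g) F \<le> 2" .
    qed
  qed (rule nonneg)
  moreover have "\<forall>\<gamma>. \<gamma> \<notin> multiindices A \<longrightarrow> g \<gamma> = 0"
    using bound by (simp add: g_def l2_neg_def del: neumann.simps)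
  ultimately have "g \<in> l2_neg A a p"
    by (simp add: l2_neg_def)
  moreover have "p \<in> {1..}"
    using q0(1) q(1) by (simp add: p_def)
  ultimately have "g \<in> dual_space A a"
    unfolding dual_space_def by blast
  then show thesis using that fixpoint by blast
qed

section \<open>Inversion of a general element\<close>

lemma l2_neg_scale: "f \<in> l2_neg A a p \<Longrightarrow> (\<lambda>\<alpha>. c * f \<alpha>) \<in> l2_neg A a p"
  using summable_on_cmult_right[of "\<lambda>\<alpha>. (cmod (f \<alpha>))\<^sup>2 / a \<alpha> ^ p" "multiindices A" "(cmod c)\<^sup>2"]
  by (auto simp: l2_neg_def norm_mult power_mult_distrib)

lemma dual_space_scale: "f \<in> dual_space A a \<Longrightarrow> (\<lambda>\<alpha>. c * f \<alpha>) \<in> dual_space A a"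
  by (auto simp: dual_space_def intro: l2_neg_scale)

text \<open>Only one nonnegative summand is removed. This provides the part of \<open>f\<close> with
  zero expectation.\<close>

lemma dual_space_erase_zero:
  assumes "f \<in> dual_space A a"
  shows "(\<lambda>\<alpha>. if \<alpha> = 0 then 0 else f \<alpha>) \<in> dual_space A a"
proof -
  obtain p where p: "p \<ge> 1" "f \<in> l2_neg A a p"
    using assms by (auto simp: dual_space_def)
  let ?f = "\<lambda>\<alpha>. if \<alpha> = 0 then 0 else f \<alpha>"
  have "(\<lambda>\<alpha>. (cmod (f \<alpha>))\<^sup>2 / a \<alpha> ^ p) summable_on (multiindices A - {0})"
    by (rule summable_on_subset_banach[of _ "multiindices A"]) (use p(2) in \<open>auto simp: l2_neg_def\<close>)
  also have "?this \<longleftrightarrow> (\<lambda>\<alpha>. (cmod (?f \<alpha>))\<^sup>2 / a \<alpha> ^ p) summable_on multiindices A"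
    by (rule summable_on_cong_neutral) auto
  finally show ?thesis
    using p by (auto simp: dual_space_def l2_neg_def)
qed

lemma vage_space_inverse:
  assumes vage: "vage_space A a" and f: "f \<in> dual_space A a" "f 0 \<noteq> 0"
  obtains g where "g \<in> dual_space A a" "convolution A f g = unit_vec 0"
proof -
  define c where "c = f 0"
  \<comment> \<open>The sign and the factor are chosen so that f = c (1 - h); the inverse of
    \<open>f\<close> is then the inverse of 1 - h divided by c.\<close>
  define h where "h = (\<lambda>\<alpha>. (- inverse c) * (if \<alpha> = 0 then 0 else f \<alpha>))"
  have "h \<in> dual_space A a"
    unfolding h_def by (rule dual_space_scale[OF dual_space_erase_zero[OF f(1)]])
  moreover have "h 0 = 0"
    by (simp add: h_def)
  ultimately obtain g where g: "g \<in> dual_space A a" "\<And>\<gamma>. g \<gamma> = unit_vec 0 \<gamma> + convolution A h g \<gamma>"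
    using vage_space_one_minus_invertible[OF vage, of h] by blast
  have f_eq: "f = (\<lambda>\<alpha>. c * (unit_vec 0 \<alpha> - h \<alpha>))"
    using f(2) by (auto simp: h_def unit_vec_def c_def)
  have g0: "convolution A (unit_vec 0) g = g"
    using g(1) by (intro convolution_one_left) (auto simp: dual_space_def l2_neg_def)
  have "convolution A f (\<lambda>\<alpha>. inverse c * g \<alpha>) \<gamma> = unit_vec 0 \<gamma>" for \<gamma>
  proof -
    have "convolution A f (\<lambda>\<alpha>. inverse c * g \<alpha>) \<gamma> = c * inverse c * (g \<gamma> - convolution A h g \<gamma>)"
      by (subst f_eq) (simp only: convolution_scale convolution_diff_left g0)
    also have "\<dots> = unit_vec 0 \<gamma>"
      using g(2)[of \<gamma>] f(2) by (simp add: c_def)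
    finally show ?thesis .
  qed
  then show thesis
    using that dual_space_scale[OF g(1)] by blast
qed

theorem proposition4p6:
  fixes A :: "nat set" and a :: "(nat \<Rightarrow>\<^sub>0 nat) \<Rightarrow> real"
    and f :: "(nat \<Rightarrow>\<^sub>0 nat) \<Rightarrow> complex"
  assumes "A \<subseteq> {1..}"
    and "vage_space A a"
    and "f \<in> carrier (dual_ring A a)"
  shows "f \<in> Units (dual_ring A a) \<longleftrightarrow> expectation f \<noteq> 0"
proof
  assume "f \<in> Units (dual_ring A a)"
  then obtain g where "convolution A f g = unit_vec 0"
    by (auto simp: Units_def dual_ring_def unit_vec_def)
  then have "f 0 * g 0 = 1"
    using convolution_at_zero[of A f g] by (simp add: unit_vec_def)
  then show "expectation f \<noteq> 0"
    by (auto simp: expectation_def)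
next
  assume "expectation f \<noteq> 0"
  then have "f 0 \<noteq> 0"
    by (simp add: expectation_def)
  have f: "f \<in> dual_space A a"
    using assms(3) by (simp add: dual_ring_def)
  obtain g where "g \<in> dual_space A a" "convolution A f g = unit_vec 0"
    using vage_space_inverse[OF assms(2) f \<open>f 0 \<noteq> 0\<close>] .
  \<comment> \<open>\<open>Units\<close> asks for a two-sided inverse; commutativity of convolution
    supplies the other side.\<close>
  then show "f \<in> Units (dual_ring A a)"
    using f convolution_commute[of A g f] by (auto simp: Units_def dual_ring_def unit_vec_def)
qed

end
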